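(* Let $\lambda\in\mathbb{R}$ and let $r\ge 0$ be an integer. For every integer $n\ge 0$, $$\frac{n!}{2^{n}}=\sum_{k=0}^{n}(-1)^{k}{n+r \brack k+r}_{r,\lambda}\mathcal{E}_{k,\lambda}(r).$$
   Context: For $\lambda\in\mathbb{R}$ put $(x)_{0,\lambda}=1$, $(x)_{n,\lambda}=x(x-\lambda)\cdots(x-(n-1)\lambda)$ and $\langle x\rangle_{0,\lambda}=1$, $\langle x\rangle_{n,\lambda}=x(x+\lambda)\cdots(x+(n-1)\lambda)$ for $n\ge 1$. Also $\langle x\rangle_0=1$ and $\langle x\rangle_n=x(x+1)\cdots(x+n-1)$ for $n\ge1$. For an integer $r\ge 0$, the unsigned degenerate $r$-Stirling numbers of the first kind ${n+r \brack k+r}_{r,\lambda}$ ($0\le k\le n$) are defined by the polynomial identity in $x$: $\langle x+r\rangle_{n}=\sum_{k=0}^{n}{n+r \brack k+r}_{r,\lambda}\langle x\rangle_{k,\lambda}$ for $n\ge 0$. The degenerate exponential functions are the formal power series $e_{\lambda}^{x}(t)=\sum_{n=0}^{\infty}(x)_{n,\lambda}\frac{t^{n}}{n!}$, with $e_\lambda(t)=e_\lambda^1(t)$. The degenerate Euler polynomials $\mathcal{E}_{n,\lambda}(x)$ are defined by the formal power series identity $$\frac{2}{e_{\lambda}(t)+1}e_{\lambda}^{x}(t)=\sum_{n=0}^{\infty}\mathcal{E}_{n,\lambda}(x)\frac{t^{n}}{n!}.$$ *)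

theory Defs
  imports Complex_Main "HOL-Computational_Algebra.Computational_Algebra"
begin

definition deg_falling :: "'a::comm_ring_1 \<Rightarrow> 'a \<Rightarrow> nat \<Rightarrow> 'a" where
  "deg_falling l x n = (\<Prod>i<n. x - of_nat i * l)"

definition deg_rising :: "'a::comm_ring_1 \<Rightarrow> 'a \<Rightarrow> nat \<Rightarrow> 'a" where
  "deg_rising l x n = (\<Prod>i<n. x + of_nat i * l)"

text \<open>
  The defining relation is an identity in the polynomial ring over the reals: the indeterminate
  is \<open>[:0, 1:]\<close>, the argument \<open>x + r\<close> is \<open>[:real r, 1:]\<close>, and \<open>pochhammer\<close> is the ordinary
  rising factorial. The number with upper index \<open>n + r\<close> and lower index \<open>k + r\<close> is
  \<open>deg_r_stirling1 r l n k\<close>; it is set to 0 for \<open>k > n\<close>, where the relation says nothing.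
\<close>

definition deg_r_stirling1_rel :: "nat \<Rightarrow> real \<Rightarrow> nat \<Rightarrow> (nat \<Rightarrow> real) \<Rightarrow> bool" where
  "deg_r_stirling1_rel r l n c \<longleftrightarrow>
     pochhammer [:real r, 1:] n = (\<Sum>k\<le>n. smult (c k) (deg_rising [:l:] [:0, 1:] k)) \<and>
     (\<forall>k>n. c k = 0)"

definition deg_r_stirling1 :: "nat \<Rightarrow> real \<Rightarrow> nat \<Rightarrow> nat \<Rightarrow> real" where
  "deg_r_stirling1 r l n = (THE c. deg_r_stirling1_rel r l n c)"

definition deg_exp :: "real \<Rightarrow> real \<Rightarrow> real fps" where
  "deg_exp l x = Abs_fps (\<lambda>n. deg_falling l x n / fact n)"

definition deg_euler :: "nat \<Rightarrow> real \<Rightarrow> real \<Rightarrow> real" where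
  "deg_euler n l x = fact n * fps_nth (2 / (deg_exp l 1 + 1) * deg_exp l x) n"

text \<open>Both implicit definitions are well posed.\<close>

lemma deg_rising_poly_Suc:
  "deg_rising [:l:] [:0, 1:] (Suc k) =
     deg_rising [:l:] [:0, 1:] k * [:real k * l, 1:]"
  by (simp add: deg_rising_def of_nat_poly mult.commute)

lemma deg_rising_poly_monic:
  fixes l :: real
  shows "degree (deg_rising [:l:] [:0, 1:] k) = k \<and> lead_coeff (deg_rising [:l:] [:0, 1:] k) = 1"
proof (induction k)
  case 0
  show ?case by (simp add: deg_rising_def)
next
  case (Suc k)
  then have "deg_rising [:l:] [:0, 1:] k \<noteq> 0"
    by auto
  then have "degree (deg_rising [:l:] [:0, 1:] k * [:real k * l, 1:]) = Suc k"
    using Suc by (subst degree_mult_eq) auto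
  moreover have "lead_coeff (deg_rising [:l:] [:0, 1:] k * [:real k * l, 1:]) = 1"
    using Suc by (subst lead_coeff_mult) auto
  ultimately show ?case
    by (simp only: deg_rising_poly_Suc)
qed

lemma deg_rising_poly_span:
  fixes p :: "real poly"
  assumes "degree p \<le> n"
  shows "\<exists>c. p = (\<Sum>k\<le>n. smult (c k) (deg_rising [:l:] [:0, 1:] k))"
  using assms
proof (induction n arbitrary: p)
  case 0
  then obtain a where "p = [:a:]"
    using degree_eq_zeroE by blast
  then show ?case
    by (intro exI[of _ "\<lambda>_. a"]) (simp add: deg_rising_def)
next
  case (Suc n)
  let ?b = "deg_rising [:l:] [:0, 1:] (Suc n)"
  let ?q = "p - smult (coeff p (Suc n)) ?b"
  have b: "degree ?b = Suc n" "coeff ?b (Suc n) = 1"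
    using deg_rising_poly_monic[of l "Suc n"] by metis+
  have "coeff ?q m = 0" if "n < m" for m
  proof (cases "m = Suc n")
    case False
    with that have "Suc n < m" by simp
    then show ?thesis
      using Suc.prems b by (simp add: coeff_eq_0)
  qed (use b in simp)
  then have "degree ?q \<le> n"
    by (intro degree_le) blast
  from Suc.IH[OF this] obtain c where
    c: "?q = (\<Sum>k\<le>n. smult (c k) (deg_rising [:l:] [:0, 1:] k))" by blast
  have "p = ?q + smult (coeff p (Suc n)) ?b" by simp
  also have "\<dots> = (\<Sum>k\<le>Suc n. smult ((c(Suc n := coeff p (Suc n))) k)
                    (deg_rising [:l:] [:0, 1:] k))"
    by (simp add: c)
  finally show ?case by blast
qed

lemma deg_rising_poly_indep:
  fixes d :: "nat \<Rightarrow> real"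
  assumes "(\<Sum>k\<le>n. smult (d k) (deg_rising [:l:] [:0, 1:] k)) = 0" and "k \<le> n"
  shows "d k = 0"
  using assms
proof (induction n)
  case 0
  then show ?case by (simp add: deg_rising_def)
next
  case (Suc n)
  let ?b = "\<lambda>k. deg_rising [:l:] [:0, 1:] k"
  have low: "coeff (?b k) (Suc n) = 0" if "k \<le> n" for k
    using that deg_rising_poly_monic[of l k] by (intro coeff_eq_0) simp
  have top: "coeff (?b (Suc n)) (Suc n) = 1"
    using deg_rising_poly_monic[of l "Suc n"] by metis
  have "0 = coeff (\<Sum>k\<le>Suc n. smult (d k) (?b k)) (Suc n)"
    by (simp only: Suc.prems coeff_0)
  also have "\<dots> = d (Suc n)"
    by (simp add: coeff_sum low top)
  finally have d: "d (Suc n) = 0" by simp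
  then show ?case
    using Suc by (cases "k = Suc n") auto
qed

lemma deg_r_stirling1_rel_ex1: "\<exists>!c. deg_r_stirling1_rel r l n c"
proof -
  have deg: "degree (pochhammer [:real r, 1:] n) \<le> n"
  proof (induction n)
    case (Suc n)
    have "degree ([:real r, 1:] + of_nat n) \<le> 1"
      by (simp add: of_nat_poly)
    with Suc show ?case
      using degree_mult_le[of "pochhammer [:real r, 1:] n" "[:real r, 1:] + of_nat n"]
      by (simp add: pochhammer_Suc)
  qed simp
  obtain c where
    c: "pochhammer [:real r, 1:] n = (\<Sum>k\<le>n. smult (c k) (deg_rising [:l:] [:0, 1:] k))"
    using deg_rising_poly_span[OF deg] by blast
  have ex: "deg_r_stirling1_rel r l n (\<lambda>k. if k \<le> n then c k else 0)"
    unfolding deg_r_stirling1_rel_def by (simp add: c)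
  have "c1 = c2" if "deg_r_stirling1_rel r l n c1" "deg_r_stirling1_rel r l n c2" for c1 c2
  proof
    fix k
    have "(\<Sum>k\<le>n. smult (c1 k - c2 k) (deg_rising [:l:] [:0, 1:] k)) = 0"
      using that by (simp add: deg_r_stirling1_rel_def smult_diff_left sum_subtractf)
    then have "c1 k - c2 k = 0" if "k \<le> n"
      using deg_rising_poly_indep[of "\<lambda>k. c1 k - c2 k"] that by blast
    then show "c1 k = c2 k"
      using that by (cases "k \<le> n") (auto simp: deg_r_stirling1_rel_def)
  qed
  with ex show ?thesis by blast
qed

lemma deg_r_stirling1_poly:
  "pochhammer [:real r, 1:] n =
     (\<Sum>k\<le>n. smult (deg_r_stirling1 r l n k) (deg_rising [:l:] [:0, 1:] k))"
  using theI'[OF deg_r_stirling1_rel_ex1[of r l n]]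
  by (simp add: deg_r_stirling1_def deg_r_stirling1_rel_def)

lemma deg_euler_fps:
  "2 / (deg_exp l 1 + 1) * deg_exp l x = Abs_fps (\<lambda>n. deg_euler n l x / fact n)"
  by (rule fps_ext) (simp add: deg_euler_def)

text \<open>
  The denominator has constant term 2, so the quotient of power series is a genuine one.
\<close>

lemma deg_euler_denominator:
  "2 / (deg_exp l 1 + 1) * (deg_exp l 1 + 1) = (2 :: real fps)"
proof -
  have "fps_nth (deg_exp l 1 + 1) 0 \<noteq> 0"
    by (simp add: deg_exp_def deg_falling_def)
  then show ?thesis
    by (simp add: fps_divide_unit mult.assoc inverse_mult_eq_1)
qed

end

theory Submission imports Defs
begin

text \<open>
  Write \<open>E\<^sub>k(x)\<close> for the degenerate Euler polynomial and \<open>(x)\<^sub>k\<close> for the degenerate falling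
  factorial. The generating function of the \<open>E\<^sub>k\<close> says that averaging over a unit step turns
  \<open>E\<^sub>k\<close> into \<open>(x)\<^sub>k\<close>: one has \<open>(E\<^sub>k(x) + E\<^sub>k(x + 1)) / 2 = (x)\<^sub>k\<close>
  (lemma \<open>deg_euler_average\<close>), and it makes \<open>E\<^sub>k\<close> a polynomial of degree at most \<open>k\<close>. With the
  operator \<open>T f(x) = (f(x) - f(x + 1)) / 2\<close> the average is \<open>1 - T\<close>. Since \<open>T\<close> lowers degrees, \<open>1 - T\<close> is inverted on polynomials of degree at most \<open>n\<close>
  by the truncated geometric series \<open>1 + T + \<dots> + T\<^sup>n\<close>. This series therefore sends \<open>(x)\<^sub>k\<close> to
  \<open>E\<^sub>k(x)\<close> for \<open>k \<le> n\<close> (lemma \<open>deg_euler_eq_sum_neg_half_diff\<close>).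

  Substituting \<open>x = - y\<close> in the relation that defines the Stirling numbers turns the rising
  factorials on the right into \<open>(-1)\<^sup>k (y)\<^sub>k\<close>, and the left-hand side into the ordinary rising
  factorial of \<open>r - y\<close>. Apply the geometric series to both sides and evaluate at \<open>y = r\<close>. The right-hand
  side becomes the sum of the theorem. On the left, \<open>T\<close> acts on ordinary rising factorials of
  \<open>r - y\<close> like half a derivative acts on powers, so at \<open>y = r\<close> only the term \<open>T\<^sup>n\<close> survives, and
  it equals \<open>n! / 2\<^sup>n\<close> (lemma \<open>neg_half_diff_pow_pochhammer_at_root\<close>).
\<close>

section \<open>The addition law of degenerate exponentials\<close>

lemma deg_falling_0 [simp]: "deg_falling l x 0 = 1"
  by (simp add: deg_falling_def)

lemma deg_falling_Suc: "deg_falling l x (Suc n) = deg_falling l x n * (x - of_nat n * l)"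
  by (simp add: deg_falling_def)

text \<open>
  Formally, the degenerate exponential is \<open>(1 + l t) powr (x / l)\<close>; the differential equation below is
  meaningful for \<open>l = 0\<close> as well and so treats the ordinary exponential on the same footing.
\<close>

lemma deg_exp_ode:
  "(1 + fps_const l * fps_X) * fps_deriv (deg_exp l x) = fps_const x * deg_exp l x"
proof (rule fps_ext)
  fix n
  show "fps_nth ((1 + fps_const l * fps_X) * fps_deriv (deg_exp l x)) n =
        fps_nth (fps_const x * deg_exp l x) n"
    by (cases n) (simp_all add: deg_exp_def deg_falling_Suc distrib_right mult.assoc field_simps
        del: of_nat_Suc)
qed

lemma deg_exp_unique:
  assumes ode: "(1 + fps_const l * fps_X) * fps_deriv F = fps_const x * F"
    and init: "fps_nth F 0 = 1"
  shows "F = deg_exp l x"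
proof (rule fps_ext)
  fix n
  show "fps_nth F n = fps_nth (deg_exp l x) n"
  proof (induction n)
    case 0
    show ?case by (simp add: init deg_exp_def)
  next
    case (Suc n)
    have rec: "real (Suc n) * fps_nth F (Suc n) = (x - real n * l) * fps_nth F n"
      using arg_cong[OF ode, of "\<lambda>G. fps_nth G n"]
      by (cases n) (simp_all add: distrib_right mult.assoc algebra_simps)
    have "fps_nth F (Suc n) = (x - real n * l) * fps_nth F n / real (Suc n)"
      using rec by (simp add: field_simps del: of_nat_Suc)
    also have "\<dots> = fps_nth (deg_exp l x) (Suc n)"
      by (simp add: Suc.IH deg_exp_def deg_falling_Suc mult.commute del: of_nat_Suc)
    finally show ?case .
  qed
qed

lemma deg_exp_add: "deg_exp l x * deg_exp l y = deg_exp l (x + y)"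
proof (rule deg_exp_unique)
  let ?D = "1 + fps_const l * fps_X"
  have "?D * fps_deriv (deg_exp l x * deg_exp l y) =
        deg_exp l x * (?D * fps_deriv (deg_exp l y)) + (?D * fps_deriv (deg_exp l x)) * deg_exp l y"
    by (simp add: algebra_simps)
  also have "\<dots> = fps_const (x + y) * (deg_exp l x * deg_exp l y)"
    by (simp only: deg_exp_ode fps_const_add[symmetric]) (simp add: algebra_simps del: fps_const_add)
  finally show "?D * fps_deriv (deg_exp l x * deg_exp l y) =
    fps_const (x + y) * (deg_exp l x * deg_exp l y)" .
  show "fps_nth (deg_exp l x * deg_exp l y) 0 = 1"
    by (simp add: deg_exp_def)
qed

section \<open>Degenerate Euler polynomials\<close>

text \<open>
  Moving from \<open>x\<close> to \<open>x + 1\<close> multiplies the generating function by \<open>deg_exp l 1\<close>, so the sum of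
  both cancels the denominator \<open>deg_exp l 1 + 1\<close>.
\<close>

lemma deg_euler_average:
  "(deg_euler k l x + deg_euler k l (x + 1)) / 2 = deg_falling l x k"
proof -
  let ?Q = "2 / (deg_exp l 1 + 1) :: real fps"
  have "?Q * deg_exp l x + ?Q * deg_exp l (x + 1) = ?Q * (deg_exp l 1 + 1) * deg_exp l x"
    unfolding add.commute[of x 1] deg_exp_add[symmetric] distrib_left distrib_right
      mult_1_right mult.assoc
    by (rule add.commute)
  also have "\<dots> = fps_const 2 * deg_exp l x"
    by (simp only: deg_euler_denominator numeral_fps_const[symmetric])
  finally have sum: "?Q * deg_exp l x + ?Q * deg_exp l (x + 1) = fps_const 2 * deg_exp l x" .
  have "fps_nth (?Q * deg_exp l x) k + fps_nth (?Q * deg_exp l (x + 1)) k =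
      2 * (deg_falling l x k / fact k)"
    unfolding fps_add_nth[symmetric] sum by (simp add: deg_exp_def)
  then have "fact k * (fps_nth (?Q * deg_exp l x) k + fps_nth (?Q * deg_exp l (x + 1)) k) =
      2 * deg_falling l x k"
    by simp
  then show ?thesis
    unfolding deg_euler_def by (simp add: distrib_left)
qed

text \<open>This expansion shows that \<open>deg_euler k l\<close> is a polynomial function of degree at most \<open>k\<close>.\<close>

lemma deg_euler_deg_falling_expansion:
  "deg_euler k l x =
    (\<Sum>j\<le>k. fact k * fps_nth (2 / (deg_exp l 1 + 1)) (k - j) / fact j * deg_falling l x j)"
proof -
  have "fps_nth (deg_exp l x * (2 / (deg_exp l 1 + 1))) k =
     (\<Sum>j\<le>k. deg_falling l x j / fact j * fps_nth (2 / (deg_exp l 1 + 1)) (k - j))"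
    by (simp add: fps_mult_nth deg_exp_def atLeast0AtMost)
  then show ?thesis
    unfolding deg_euler_def mult.commute[of "2 / (deg_exp l 1 + 1)"]
    by (simp add: sum_distrib_left mult_ac)
qed

section \<open>The negative half difference operator\<close>

definition neg_half_diff :: "(real \<Rightarrow> real) \<Rightarrow> real \<Rightarrow> real" where
  "neg_half_diff f x = (f x - f (x + 1)) / 2"

lemma neg_half_diff_sum:
  "neg_half_diff (\<lambda>x. \<Sum>k\<in>A. c k * f k x) = (\<lambda>x. \<Sum>k\<in>A. c k * neg_half_diff (f k) x)"
proof
  fix x
  have "(\<Sum>k\<in>A. c k * neg_half_diff (f k) x) = (\<Sum>k\<in>A. (c k * f k x - c k * f k (x + 1)) / 2)"
    by (simp add: neg_half_diff_def right_diff_distrib)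
  then show "neg_half_diff (\<lambda>x. \<Sum>k\<in>A. c k * f k x) x = (\<Sum>k\<in>A. c k * neg_half_diff (f k) x)"
    by (simp add: neg_half_diff_def sum_subtractf flip: sum_divide_distrib)
qed

lemma neg_half_diff_pow_sum:
  "(neg_half_diff ^^ m) (\<lambda>x. \<Sum>k\<in>A. c k * f k x) = (\<lambda>x. \<Sum>k\<in>A. c k * (neg_half_diff ^^ m) (f k) x)"
  by (induction m) (simp_all add: neg_half_diff_sum)

lemma neg_half_diff_diff:
  "neg_half_diff (\<lambda>x. f x - g x) = (\<lambda>x. neg_half_diff f x - neg_half_diff g x)"
  by (simp add: neg_half_diff_def fun_eq_iff field_simps)

lemma neg_half_diff_pow_diff:
  "(neg_half_diff ^^ m) (\<lambda>x. f x - g x) = (\<lambda>x. (neg_half_diff ^^ m) f x - (neg_half_diff ^^ m) g x)"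
  by (induction m) (simp_all add: neg_half_diff_diff)

lemma neg_half_diff_shift_half:
  "neg_half_diff (\<lambda>x. f (x + 1) / 2) = (\<lambda>x. neg_half_diff f (x + 1) / 2)"
  by (simp add: neg_half_diff_def fun_eq_iff field_simps)

lemma neg_half_diff_pow_shift_half:
  "(neg_half_diff ^^ m) (\<lambda>x. f (x + 1) / 2) = (\<lambda>x. (neg_half_diff ^^ m) f (x + 1) / 2)"
  by (induction m) (simp_all add: neg_half_diff_shift_half)

text \<open>
  The degree argument for functions: by the product rule, one further linear factor is killed by
  one further application of the operator.
\<close>

lemma neg_half_diff_pow_linear_factor:
  assumes "(neg_half_diff ^^ m) f = (\<lambda>_. 0)"
  shows "(neg_half_diff ^^ Suc m) (\<lambda>x. f x * (x - c)) = (\<lambda>_. 0)"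
  using assms
proof (induction m arbitrary: f)
  case 0
  then show ?case by (simp add: neg_half_diff_def fun_eq_iff)
next
  case (Suc m)
  have "neg_half_diff (\<lambda>x. f x * (x - c)) =
      (\<lambda>x. neg_half_diff f x * (x - c) - f (x + 1) / 2)"
    by (simp add: neg_half_diff_def fun_eq_iff field_simps)
  then have "(neg_half_diff ^^ Suc (Suc m)) (\<lambda>x. f x * (x - c)) =
      (neg_half_diff ^^ Suc m) (\<lambda>x. neg_half_diff f x * (x - c) - f (x + 1) / 2)"
    by (simp only: funpow_Suc_right[of "Suc m"] comp_apply)
  also have "\<dots> = (\<lambda>x. (neg_half_diff ^^ Suc m) (\<lambda>x. neg_half_diff f x * (x - c)) x -
      (neg_half_diff ^^ Suc m) f (x + 1) / 2)"
    by (simp only: neg_half_diff_pow_diff neg_half_diff_pow_shift_half)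
  also have "(neg_half_diff ^^ Suc m) (\<lambda>x. neg_half_diff f x * (x - c)) = (\<lambda>_. 0)"
    using Suc.prems by (intro Suc.IH) (simp only: funpow_Suc_right comp_apply)
  finally show ?case
    by (simp only: Suc.prems) simp
qed

lemma neg_half_diff_pow_deg_falling:
  assumes "k \<le> n"
  shows "(neg_half_diff ^^ Suc n) (\<lambda>x. deg_falling l x k) = (\<lambda>_. 0)"
  using assms
proof (induction k arbitrary: n)
  case 0
  have "neg_half_diff (\<lambda>_. 1) = (\<lambda>_. 0)" "(neg_half_diff ^^ m) (\<lambda>_. 0) = (\<lambda>_. 0)" for m
    by (induction m) (simp_all add: neg_half_diff_def fun_eq_iff)
  then show ?case
    by (simp only: deg_falling_0 funpow_Suc_right comp_apply)
next
  case (Suc k)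
  then obtain m where m: "n = Suc m" "k \<le> m"
    by (cases n) auto
  show ?case
    using neg_half_diff_pow_linear_factor[OF Suc.IH[OF m(2)]] by (simp only: m(1) deg_falling_Suc)
qed

text \<open>
  The average of \<open>f\<close> over a unit step is \<open>f - neg_half_diff f\<close>, so the geometric series telescopes.
\<close>

lemma sum_neg_half_diff_pow_average:
  "(\<Sum>m\<le>n. (neg_half_diff ^^ m) (\<lambda>x. (f x + f (x + 1)) / 2) x) =
    f x - (neg_half_diff ^^ Suc n) f x"
proof -
  have "(\<lambda>x. (f x + f (x + 1)) / 2) = (\<lambda>x. f x - neg_half_diff f x)"
    by (simp add: neg_half_diff_def fun_eq_iff field_simps)
  then have "(neg_half_diff ^^ m) (\<lambda>x. (f x + f (x + 1)) / 2) x =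
      (neg_half_diff ^^ m) f x - (neg_half_diff ^^ Suc m) f x" for m
    by (simp only: neg_half_diff_pow_diff funpow_Suc_right comp_apply)
  then show ?thesis
    by (simp only: sum_telescope[where f = "\<lambda>m. (neg_half_diff ^^ m) f x"] funpow_0)
qed

lemma deg_euler_eq_sum_neg_half_diff:
  assumes "k \<le> n"
  shows "deg_euler k l x = (\<Sum>m\<le>n. (neg_half_diff ^^ m) (\<lambda>x. deg_falling l x k) x)"
proof -
  have "(neg_half_diff ^^ Suc n) (deg_euler k l) x = 0"
    unfolding deg_euler_deg_falling_expansion[abs_def] neg_half_diff_pow_sum
    using assms by (intro sum.neutral) (simp add: neg_half_diff_pow_deg_falling del: funpow.simps)
  then show ?thesis
    using sum_neg_half_diff_pow_average[of "deg_euler k l" x n]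
    by (simp only: deg_euler_average)
qed

section \<open>Rising factorials and the main identity\<close>

lemma neg_half_diff_pochhammer:
  "neg_half_diff (\<lambda>y. pochhammer (a - y) (Suc n)) = (\<lambda>y. real (Suc n) / 2 * pochhammer (a - y) n)"
proof
  fix y
  have "pochhammer (a - (y + 1)) (Suc n) = (a - (y + 1)) * pochhammer (a - y) n"
    using pochhammer_rec[of "a - (y + 1)" n] by simp
  moreover have "pochhammer (a - y) (Suc n) = (a - y + real n) * pochhammer (a - y) n"
    by (simp add: pochhammer_Suc)
  ultimately show "neg_half_diff (\<lambda>y. pochhammer (a - y) (Suc n)) y =
      real (Suc n) / 2 * pochhammer (a - y) n"
    unfolding neg_half_diff_def by (simp add: field_simps)
qed

text \<open>
  Each application lowers the order of the rising factorial by one and contributes half that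
  order as a factor; a rising factorial of positive order vanishes at \<open>y = a\<close>.
\<close>

lemma neg_half_diff_pow_pochhammer_at_root:
  assumes "m \<le> n"
  shows "(neg_half_diff ^^ m) (\<lambda>y. pochhammer (a - y) n) a = (if m = n then fact n / 2 ^ n else 0)"
  using assms
proof (induction n arbitrary: m)
  case (Suc n)
  show ?case
  proof (cases m)
    case (Suc m')
    have "(neg_half_diff ^^ m) (\<lambda>y. pochhammer (a - y) (Suc n)) a =
        (neg_half_diff ^^ m') (\<lambda>y. real (Suc n) / 2 * pochhammer (a - y) n) a"
      by (simp only: Suc funpow_Suc_right comp_apply neg_half_diff_pochhammer)
    also have "\<dots> = real (Suc n) / 2 * (neg_half_diff ^^ m') (\<lambda>y. pochhammer (a - y) n) a"
      using neg_half_diff_pow_sum[of m' "\<lambda>_. real (Suc n) / 2" "\<lambda>_ y. pochhammer (a - y) n" "{0::nat}"]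
      by simp
    also have "(neg_half_diff ^^ m') (\<lambda>y. pochhammer (a - y) n) a =
        (if m' = n then fact n / 2 ^ n else 0)"
      using Suc Suc.prems by (intro Suc.IH) simp
    also have "real (Suc n) / 2 * (if m' = n then fact n / 2 ^ n else 0) =
        (if m = Suc n then fact (Suc n) / 2 ^ Suc n else 0)"
      by (simp add: Suc)
    finally show ?thesis .
  qed (simp add: pochhammer_rec)
qed simp

lemma poly_deg_rising_minus:
  "poly (deg_rising [:l:] [:0, 1:] k) (- y) = (- 1) ^ k * deg_falling l y k"
  by (induction k)
    (simp_all add: deg_rising_poly_Suc deg_falling_Suc deg_rising_def algebra_simps del: of_nat_Suc)

lemma poly_pochhammer: "poly (pochhammer p n) x = pochhammer (poly p x) n"
  by (induction n) (simp_all add: pochhammer_Suc)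

lemma pochhammer_eq_sum_deg_falling:
  "pochhammer (real r - y) n =
    (\<Sum>k\<le>n. ((- 1) ^ k * deg_r_stirling1 r l n k) * deg_falling l y k)"
  using arg_cong[OF deg_r_stirling1_poly[of r n l], of "\<lambda>p. poly p (- y)"]
  by (simp add: poly_pochhammer poly_sum poly_deg_rising_minus mult_ac)

theorem theorem6:
  fixes l :: real and r n :: nat
  shows "fact n / 2 ^ n = (\<Sum>k=0..n. (-1) ^ k * deg_r_stirling1 r l n k * deg_euler k l (real r))"
proof -
  let ?c = "\<lambda>k. (-1) ^ k * deg_r_stirling1 r l n k"
  have "fact n / 2 ^ n = (\<Sum>m\<le>n. (neg_half_diff ^^ m) (\<lambda>y. pochhammer (real r - y) n) (real r))"
    by (simp add: neg_half_diff_pow_pochhammer_at_root)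
  also have "\<dots> = (\<Sum>m\<le>n. \<Sum>k\<le>n. ?c k * (neg_half_diff ^^ m) (\<lambda>y. deg_falling l y k) (real r))"
    by (simp only: pochhammer_eq_sum_deg_falling[of r _ n l] neg_half_diff_pow_sum)
  also have "\<dots> = (\<Sum>k\<le>n. ?c k * (\<Sum>m\<le>n. (neg_half_diff ^^ m) (\<lambda>y. deg_falling l y k) (real r)))"
    by (subst sum.swap) (simp only: sum_distrib_left)
  also have "\<dots> = (\<Sum>k\<le>n. ?c k * deg_euler k l (real r))"
    by (intro sum.cong refl) (simp only: deg_euler_eq_sum_neg_half_diff[symmetric] atMost_iff)
  finally show ?thesis
    by (simp only: atLeast0AtMost)
qed

end
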